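(* Let $Q=[0,1]\cap\mathbb{Q}$. There exists a bijective rational Costas cloud on $Q\times Q$: a bijection $f:Q\to Q$ which is discontinuous at every point of $Q$, whose graph $\{(x,f(x)):x\in Q\}$ is dense in $[0,1]\times[0,1]$, and which has the Costas property, i.e. for all $a_1,a_2\in Q$ and all $t\neq0$ with $t+a_1,t+a_2\in Q$, $f(t+a_1)+f(a_2)=f(t+a_2)+f(a_1)$ implies $a_1=a_2$.
   Context: For a set $A\subseteq\mathbb{Q}$, a rational Costas cloud is a nowhere continuous injection $f:A\to A$ with the Costas property (with respect to all nonzero displacements $t$ such that $(t+A)\cap A\neq\emptyset$), whose graph is dense in $I(A)\times I(A)$, where $I(A)$ is the smallest closed interval containing $A$. *)

theory Defs
  imports "HOL-Analysis.Analysis"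
begin

text \<open>
  Sets of rationals are sets of reals contained in \<open>\<rat>\<close>; a function on such a set \<open>A\<close> is a
  function \<open>real \<Rightarrow> real\<close> of which only the values on \<open>A\<close> matter.
\<close>

text \<open>
  Only displacements \<open>t\<close> with \<open>(t + A) \<inter> A \<noteq> {}\<close> are relevant here, since \<open>t + a1 \<in> A\<close> is required.
\<close>

definition costas_on :: "real set \<Rightarrow> (real \<Rightarrow> real) \<Rightarrow> bool" where
  "costas_on A f \<longleftrightarrow>
     (\<forall>a1\<in>A. \<forall>a2\<in>A. \<forall>t. t \<noteq> 0 \<longrightarrow> t + a1 \<in> A \<longrightarrow> t + a2 \<in> A \<longrightarrow>
        f (t + a1) + f a2 = f (t + a2) + f a1 \<longrightarrow> a1 = a2)"

text \<open>Closed intervals may be unbounded, so the smallest one exists for unbounded \<open>A\<close> as well.\<close>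

definition closed_interval_hull :: "real set \<Rightarrow> real set" where
  "closed_interval_hull A = \<Inter> {J. is_interval J \<and> closed J \<and> A \<subseteq> J}"

definition graph_on :: "real set \<Rightarrow> (real \<Rightarrow> real) \<Rightarrow> (real \<times> real) set" where
  "graph_on A f = {(x, f x) | x. x \<in> A}"

definition rational_costas_cloud :: "real set \<Rightarrow> (real \<Rightarrow> real) \<Rightarrow> bool" where
  "rational_costas_cloud A f \<longleftrightarrow>
     A \<subseteq> \<rat> \<and> f \<in> A \<rightarrow> A \<and> inj_on f A \<and>
     (\<forall>x\<in>A. \<not> continuous (at x within A) f) \<and>
     costas_on A f \<and>
     closed_interval_hull A \<times> closed_interval_hull A \<subseteq> closure (graph_on A f)"

lemma closed_interval_hull_unit_rationals:
  "closed_interval_hull ({0..1} \<inter> \<rat>) = {0..1}"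
proof
  show "closed_interval_hull ({0..1} \<inter> \<rat>) \<subseteq> {0..1}"
    unfolding closed_interval_hull_def by (rule Inter_lower) (auto simp: is_interval_cc)
  show "{0..1} \<subseteq> closed_interval_hull ({0..1} \<inter> \<rat>)"
    unfolding closed_interval_hull_def
  proof (intro Inter_greatest)
    fix J :: "real set"
    assume "J \<in> {J. is_interval J \<and> closed J \<and> {0..1} \<inter> \<rat> \<subseteq> J}"
    then have "is_interval J" "0 \<in> J" "1 \<in> J" by auto
    then show "{0..1} \<subseteq> J" unfolding is_interval_1 by (meson atLeastAtMost_iff subsetI)
  qed
qed

end

theory Submission
  imports Defs
begin

text \<open>
  The Costas property of \<open>f\<close> follows once the graph of \<open>f\<close> is a Sidon set in the plane. A finite
  Sidon set excludes only finitely many new points, so a back-and-forth construction over countably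
  many requirements can put one point on each vertical line, on each horizontal line and into each
  rational rectangle. Density of the graph then rules out continuity at any point.
\<close>

section \<open>Sidon sets in real vector spaces\<close>

definition sidon :: "'a::ab_group_add set \<Rightarrow> bool" where
  "sidon S \<longleftrightarrow> (\<forall>p\<in>S. \<forall>q\<in>S. \<forall>r\<in>S. \<forall>s\<in>S. p + q = r + s \<longrightarrow> p = r \<and> q = s \<or> p = s \<and> q = r)"

text \<open>These are the solutions g of g + q = r + s and of g + g = r + s whose other summands lie
  in \<open>S\<close>: the only positions where a new point could create a forbidden
  coincidence.\<close>

definition sidon_blocked :: "'a::real_vector set \<Rightarrow> 'a set" where
  "sidon_blocked S =
     (\<lambda>(q, r, s). r + s - q) ` (S \<times> S \<times> S) \<union> (\<lambda>(r, s). (1/2) *\<^sub>R (r + s)) ` (S \<times> S)"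

lemma finite_sidon_blocked: "finite S \<Longrightarrow> finite (sidon_blocked S)"
  by (simp add: sidon_blocked_def)

lemma sidon_insert:
  fixes S :: "'a::real_vector set"
  assumes S: "sidon S" and g: "g \<notin> sidon_blocked S"
  shows "sidon (insert g S)"
proof -
  have single: "g + q \<noteq> r + s" if "q \<in> S" "r \<in> S" "s \<in> S" for q r s
  proof
    assume "g + q = r + s"
    then have "g = r + s - q" by (simp add: algebra_simps)
    with that g show False by (force simp: sidon_blocked_def)
  qed
  have double: "g + g \<noteq> r + s" if "r \<in> S" "s \<in> S" for r s
  proof
    assume "g + g = r + s"
    then have "g = (1/2) *\<^sub>R (r + s)" by (metis scaleR_half_double)
    with that g show False by (force simp: sidon_blocked_def)
  qed
  show ?thesis
    unfolding sidon_def
  proof (intro ballI impI)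
    fix p q r s
    assume mem: "p \<in> insert g S" "q \<in> insert g S" "r \<in> insert g S" "s \<in> insert g S"
      and eq: "p + q = r + s"
    show "p = r \<and> q = s \<or> p = s \<and> q = r"
    \<comment> \<open>A summand common to both sides cancels, so the pairs agree trivially.\<close>
    proof (cases "p = r \<or> p = s \<or> q = r \<or> q = s")
      case True
      with eq show ?thesis by (auto simp: add.commute)
    next
      case False
      \<comment> \<open>Without a common summand, \<open>g\<close> occurs on one side only, once or
        twice. The four orientations bring it to the front of the left side, where
        \<open>single\<close> and \<open>double\<close> apply.\<close>
      have "p + q = r + s" "q + p = r + s" "r + s = p + q" "s + r = p + q"
        using eq by (simp_all add: add.commute)
      with False mem single double S show ?thesis
        unfolding sidon_def by (metis insert_iff)
    qed
  qed
qed

text \<open>Swapping coordinates is additive and injective, so it carries coincidences of sums back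
  to \<open>S\<close>.\<close>

lemma sidon_converse:
  assumes "sidon S"
  shows "sidon (S\<inverse>)"
  unfolding sidon_def
proof (intro ballI impI)
  fix p q r s
  assume "p \<in> S\<inverse>" "q \<in> S\<inverse>" "r \<in> S\<inverse>" "s \<in> S\<inverse>" and eq: "p + q = r + s"
  then have mem: "prod.swap p \<in> S" "prod.swap q \<in> S" "prod.swap r \<in> S" "prod.swap s \<in> S"
    by auto
  have "prod.swap p + prod.swap q = prod.swap r + prod.swap s"
    using eq by (simp add: prod_eq_iff)
  with assms mem have "prod.swap p = prod.swap r \<and> prod.swap q = prod.swap s \<or>
      prod.swap p = prod.swap s \<and> prod.swap q = prod.swap r"
    unfolding sidon_def by blast
  then show "p = r \<and> q = s \<or> p = s \<and> q = r"
    by (metis swap_swap)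
qed

text \<open>A coincidence involves only four points, and in an increasing chain these lie in a
  common member; the sum of their indices bounds each of them.\<close>

lemma sidon_Union_chain:
  assumes "\<And>n. sidon (S n)" "incseq S"
  shows "sidon (\<Union>n. S n)"
  unfolding sidon_def
proof (intro ballI impI)
  fix p q r s
  assume "p \<in> (\<Union>n. S n)" "q \<in> (\<Union>n. S n)" "r \<in> (\<Union>n. S n)" "s \<in> (\<Union>n. S n)"
    and eq: "p + q = r + s"
  then obtain i j k l where "p \<in> S i" "q \<in> S j" "r \<in> S k" "s \<in> S l" by blast
  then have "p \<in> S (i+j+k+l)" "q \<in> S (i+j+k+l)" "r \<in> S (i+j+k+l)" "s \<in> S (i+j+k+l)"
    using incseqD[OF assms(2), of _ "i+j+k+l"] by (meson le_add1 le_add2 subsetD trans_le_add1)+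
  with assms(1) eq show "p = r \<and> q = s \<or> p = s \<and> q = r"
    unfolding sidon_def by blast
qed

lemma inj_on_Union_chain:
  assumes "\<And>n::nat. inj_on h (S n)" "incseq S"
  shows "inj_on h (\<Union>n. S n)"
proof (rule inj_onI)
  fix p q assume "p \<in> (\<Union>n. S n)" "q \<in> (\<Union>n. S n)" and eq: "h p = h q"
  then obtain i j where "p \<in> S i" "q \<in> S j" by blast
  then have "p \<in> S (i+j)" "q \<in> S (i+j)"
    using incseqD[OF assms(2), of _ "i+j"] by (meson le_add1 le_add2 subsetD)+
  with assms(1) eq show "p = q" by (meson inj_onD)
qed

section \<open>Back-and-forth with finite partial injections\<close>

definition partial_sidon_bij :: "real set \<Rightarrow> (real \<times> real) set \<Rightarrow> bool" where
  "partial_sidon_bij A S \<longleftrightarrow> S \<subseteq> A \<times> A \<and> inj_on fst S \<and> inj_on snd S \<and> sidon S"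

text \<open>Encoding partial injections as relations makes domain and range symmetric, so reaching a
  prescribed value reduces to reaching a prescribed argument.\<close>

lemma partial_sidon_bij_converse:
  assumes "partial_sidon_bij A S"
  shows "partial_sidon_bij A (S\<inverse>)"
proof -
  have "inj_on fst S" "inj_on snd S" using assms by (auto simp: partial_sidon_bij_def)
  then have "inj_on fst (S\<inverse>)" "inj_on snd (S\<inverse>)" by (force simp: inj_on_def)+
  then show ?thesis
    using assms unfolding partial_sidon_bij_def by (auto simp: sidon_converse)
qed

lemma partial_sidon_bij_insert:
  assumes S: "partial_sidon_bij A S" "finite S"
    and x: "x \<in> A" "x \<notin> fst ` S" and Y: "infinite Y" "Y \<subseteq> A"
  obtains y where "y \<in> Y" "partial_sidon_bij A (insert (x, y) S)"
proof -
  \<comment> \<open>Avoiding these heights keeps the new point off the blocked positions and its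
    value distinct from all earlier ones. They are finitely many, so the infinite \<open>Y\<close>
    offers another.\<close>
  have "finite (snd ` (sidon_blocked S \<union> S))"
    using S(2) finite_sidon_blocked by blast
  then obtain y where y: "y \<in> Y" "y \<notin> snd ` (sidon_blocked S \<union> S)"
    using Y(1) by (meson finite_subset subsetI)
  then have "(x, y) \<notin> sidon_blocked S" "y \<notin> snd ` S"
    by force+
  then have "partial_sidon_bij A (insert (x, y) S)"
    using S x Y(2) y(1) unfolding partial_sidon_bij_def
    by (auto simp: sidon_insert inj_on_insert)
  with y(1) that show thesis by blast
qed

lemma partial_sidon_bij_extend:
  assumes S: "partial_sidon_bij A S" "finite S"
    and inf: "infinite A" "infinite X" "infinite Y" and sub: "X \<subseteq> A" "Y \<subseteq> A"
    and R: "R = X \<times> Y \<or> (\<exists>x\<in>A. R = {x} \<times> A \<or> R = A \<times> {x})"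
  obtains T where "S \<subseteq> T" "finite T" "partial_sidon_bij A T" "T \<inter> R \<noteq> {}"
proof -
  have vertical: "\<exists>T. S' \<subseteq> T \<and> finite T \<and> partial_sidon_bij A T \<and> T \<inter> {x} \<times> A \<noteq> {}"
    if S': "partial_sidon_bij A S'" "finite S'" and x: "x \<in> A" for S' x
  proof (cases "x \<in> fst ` S'")
    case True
    with S' show ?thesis unfolding partial_sidon_bij_def by fastforce
  next
    case False
    obtain y where "y \<in> A" "partial_sidon_bij A (insert (x, y) S')"
      using partial_sidon_bij_insert[OF S' x False inf(1)] by blast
    with S'(2) show ?thesis by (intro exI[of _ "insert (x, y) S'"]) auto
  qed
  consider "R = X \<times> Y" | x where "x \<in> A" "R = {x} \<times> A" | x where "x \<in> A" "R = A \<times> {x}"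
    using R by blast
  then show thesis
  proof cases
    case 1
    \<comment> \<open>The finite \<open>S\<close> uses only finitely many abscissas, so a fresh one
      is left in \<open>X\<close>.\<close>
    obtain x where x: "x \<in> X" "x \<notin> fst ` S"
      using S(2) inf(2) by (meson finite_imageI finite_subset subsetI)
    obtain y where "y \<in> Y" "partial_sidon_bij A (insert (x, y) S)"
      using partial_sidon_bij_insert[OF S _ x(2) inf(3) sub(2)] x(1) sub(1) by blast
    with that[of "insert (x, y) S"] 1 S(2) x(1) show thesis by blast
  next
    case 2
    with vertical[OF S] that show thesis by blast
  next
    case 3
    \<comment> \<open>A horizontal line for \<open>S\<close> is a vertical line for its
      converse.\<close>
    obtain T where "S\<inverse> \<subseteq> T" "finite T" "partial_sidon_bij A T" "T \<inter> {x} \<times> A \<noteq> {}"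
      using vertical[of "S\<inverse>" x] partial_sidon_bij_converse S 3(1) by (metis finite_converse)
    then have "S \<subseteq> T\<inverse>" "T\<inverse> \<inter> A \<times> {x} \<noteq> {}" "partial_sidon_bij A (T\<inverse>)" "finite (T\<inverse>)"
      by (auto simp: partial_sidon_bij_converse)
    with that 3(2) show thesis by blast
  qed
qed

lemma generic_partial_sidon_bij:
  assumes A: "countable A" "infinite A"
    and \<B>: "countable \<B>" "\<And>B. B \<in> \<B> \<Longrightarrow> infinite B \<and> B \<subseteq> A"
  obtains G where "partial_sidon_bij A G" "fst ` G = A" "snd ` G = A"
    "\<And>X Y. X \<in> \<B> \<Longrightarrow> Y \<in> \<B> \<Longrightarrow> G \<inter> X \<times> Y \<noteq> {}"
proof -
  \<comment> \<open>Boxes will give density, vertical lines a domain equal to \<open>A\<close>, and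
    horizontal lines surjectivity.\<close>
  define \<R> where "\<R> = (\<lambda>(X, Y). X \<times> Y) ` (\<B> \<times> \<B>) \<union> (\<lambda>x. {x} \<times> A) ` A \<union> (\<lambda>x. A \<times> {x}) ` A"
  have \<R>: "countable \<R>" "\<R> \<noteq> {}"
    using A \<B>(1) by (auto simp: \<R>_def)
  have extend: "\<exists>T. (partial_sidon_bij A T \<and> finite T) \<and> S \<subseteq> T \<and> T \<inter> R \<noteq> {}"
    if S: "partial_sidon_bij A S \<and> finite S" and R: "R \<in> \<R>" for S R
  proof -
    obtain X Y where "infinite X" "infinite Y" "X \<subseteq> A" "Y \<subseteq> A"
      "R = X \<times> Y \<or> (\<exists>x\<in>A. R = {x} \<times> A \<or> R = A \<times> {x})"
      using R A(2) \<B>(2) unfolding \<R>_def by blast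
    with S A(2) show ?thesis by (metis partial_sidon_bij_extend)
  qed
  have start: "\<exists>S. partial_sidon_bij A S \<and> finite S"
    by (rule exI[of _ "{}"]) (simp add: partial_sidon_bij_def sidon_def)
  \<comment> \<open>Stage \<open>n\<close> meets the \<open>n\<close>-th requirement of an
    enumeration of \<open>\<R>\<close>. Later stages only add points, so it stays met.\<close>
  obtain S where S: "\<And>n. partial_sidon_bij A (S n) \<and> finite (S n)"
    and step: "\<And>n. S n \<subseteq> S (Suc n) \<and> S (Suc n) \<inter> from_nat_into \<R> n \<noteq> {}"
    using dependent_nat_choice[where P = "\<lambda>n S. partial_sidon_bij A S \<and> finite S"
        and Q = "\<lambda>n S T. S \<subseteq> T \<and> T \<inter> from_nat_into \<R> n \<noteq> {}", OF start]
      extend from_nat_into[OF \<R>(2)] by metis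
  define G where "G = (\<Union>n. S n)"
  have chain: "incseq S" using step by (simp add: incseq_SucI)
  have G: "partial_sidon_bij A G"
    using S unfolding partial_sidon_bij_def G_def
    by (intro conjI UN_least sidon_Union_chain inj_on_Union_chain chain) auto
  have meets: "G \<inter> R \<noteq> {}" if "R \<in> \<R>" for R
    using step from_nat_into_surj[OF \<R>(1) that] unfolding G_def by blast
  have "x \<in> fst ` G \<and> x \<in> snd ` G" if "x \<in> A" for x
    using that meets[of "{x} \<times> A"] meets[of "A \<times> {x}"] unfolding \<R>_def by force
  then have "fst ` G = A" "snd ` G = A"
    using G unfolding partial_sidon_bij_def by auto
  moreover have "G \<inter> X \<times> Y \<noteq> {}" if "X \<in> \<B>" "Y \<in> \<B>" for X Y
    using that by (intro meets) (auto simp: \<R>_def)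
  ultimately show thesis using that G by blast
qed

section \<open>Cloud properties read off from the graph\<close>

lemma costas_on_if_sidon_graph:
  assumes "sidon (graph_on A f)"
  shows "costas_on A f"
  unfolding costas_on_def
proof (intro ballI allI impI)
  fix a1 a2 t
  assume mem: "a1 \<in> A" "a2 \<in> A" "t + a1 \<in> A" "t + a2 \<in> A" and t: "t \<noteq> 0"
    and eq: "f (t + a1) + f a2 = f (t + a2) + f a1"
  \<comment> \<open>The first coordinates agree automatically, so the Costas equation becomes an
    equation between sums of graph points. Of the two trivial pairings, the one with t + a1 = a1 is
    excluded by \<open>t \<noteq> 0\<close>.\<close>
  have "(t + a1, f (t + a1)) + (a2, f a2) = (t + a2, f (t + a2)) + (a1, f a1)"
    using eq by simp
  moreover have "(x, f x) \<in> graph_on A f" if "x \<in> A" for x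
    using that by (auto simp: graph_on_def)
  ultimately have "t + a1 = t + a2 \<or> t + a1 = a1"
    using assms mem unfolding sidon_def by blast
  with t show "a1 = a2" by simp
qed

text \<open>Arbitrarily close to \<open>x\<close> the graph approaches every height in the unit
  interval, in particular one far from \<open>f x\<close>.\<close>

lemma not_continuous_if_dense_graph:
  assumes dense: "{0..1} \<times> {0..1} \<subseteq> closure (graph_on A f)" and x: "x \<in> {0..1}"
  shows "\<not> continuous (at x within A) f"
proof
  assume "continuous (at x within A) f"
  then obtain d where d: "d > 0" "\<And>y. y \<in> A \<Longrightarrow> dist y x < d \<Longrightarrow> dist (f y) (f x) < 1/4"
    unfolding continuous_within_eps_delta by (meson zero_less_divide_1_iff zero_less_numeral)
  \<comment> \<open>Wherever \<open>f x\<close> lies, 0 or 1 is at distance at least 1/2 from it.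
    Two errors below 1/4, one from continuity and one from density, cannot bridge this gap.\<close>
  obtain v :: real where v: "v \<in> {0..1}" "dist v (f x) \<ge> 1/2"
  proof (cases "f x \<le> 1/2")
    case True then show thesis by (intro that[of 1]) (auto simp: dist_real_def)
  next
    case False then show thesis by (intro that[of 0]) (auto simp: dist_real_def)
  qed
  have "(x, v) \<in> closure (graph_on A f)" using dense x v(1) by blast
  moreover have "0 < min d (1/4)" using d(1) by simp
  ultimately obtain p where "p \<in> graph_on A f" "dist p (x, v) < min d (1/4)"
    unfolding closure_approachable by blast
  then obtain y where y: "y \<in> A" "dist (y, f y) (x, v) < min d (1/4)"
    unfolding graph_on_def by blast
  have "dist y x < d" "dist (f y) v < 1/4"
    using y(2) dist_fst_le[of "(y, f y)" "(x, v)"] dist_snd_le[of "(y, f y)" "(x, v)"] by auto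
  with d(2)[OF y(1)] v(2) show False
    using dist_triangle2[of v "f x" "f y"] by (simp add: dist_commute)
qed

section \<open>Intervals with rational end points\<close>

lemma rational_interval_near:
  fixes x e :: real
  assumes "x \<in> {0..1}" "e > 0"
  obtains a b where "a \<in> {0..1} \<inter> \<rat>" "b \<in> {0..1} \<inter> \<rat>" "a < b" "{a<..<b} \<subseteq> ball x e"
proof -
  \<comment> \<open>Clipping to the unit interval keeps the end points admissible. The interval
    found need not contain \<open>x\<close>, and cannot when \<open>x\<close> is 0 or 1.\<close>
  have "max 0 (x - e) < min 1 (x + e)" using assms by auto
  then obtain b where b: "b \<in> \<rat>" "max 0 (x - e) < b" "b < min 1 (x + e)"
    using Rats_dense_in_real by blast
  obtain a where a: "a \<in> \<rat>" "max 0 (x - e) < a" "a < b"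
    using Rats_dense_in_real[OF b(2)] by blast
  show thesis
    using a b by (intro that[of a b]) (auto simp: dist_real_def)
qed

lemma infinite_rational_interval:
  fixes a b :: real
  assumes "a < b"
  shows "infinite ({a<..<b} \<inter> \<rat>)"
proof
  assume fin: "finite ({a<..<b} \<inter> \<rat>)"
  have ne: "{a<..<b} \<inter> \<rat> \<noteq> {}"
    using Rats_dense_in_real[OF assms] by auto
  let ?m = "Min ({a<..<b} \<inter> \<rat>)"
  have m: "?m \<in> {a<..<b} \<inter> \<rat>" using Min_in[OF fin ne] .
  then obtain r where "r \<in> \<rat>" "a < r" "r < ?m"
    using Rats_dense_in_real[of a ?m] by auto
  with m Min_le[OF fin, of r] show False by auto
qed

theorem theorem16:
  shows "\<exists>f :: real \<Rightarrow> real.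
           bij_betw f ({0..1} \<inter> \<rat>) ({0..1} \<inter> \<rat>) \<and>
           rational_costas_cloud ({0..1} \<inter> \<rat>) f"
proof -
  define A :: "real set" where "A = {0..1} \<inter> \<rat>"
  \<comment> \<open>End points drawn from the countable set \<open>A\<close> keep the family
    countable, while the intervals still come arbitrarily close to every real point of the unit
    interval.\<close>
  define \<B> where "\<B> = (\<lambda>(a, b). {a<..<b} \<inter> \<rat>) ` ((A \<times> A) \<inter> {(a, b). a < b})"
  have cA: "countable A" by (simp add: A_def countable_rat)
  have c\<B>: "countable \<B>" using cA by (auto simp: \<B>_def)
  have \<B>: "infinite B \<and> B \<subseteq> A" if "B \<in> \<B>" for B
    using that infinite_rational_interval by (auto simp: \<B>_def A_def)
  have "infinite A"
    using infinite_rational_interval[of 0 1] unfolding A_def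
    by (rule infinite_super[rotated]) auto
  from generic_partial_sidon_bij[OF cA this c\<B> \<B>]
  obtain G where G: "partial_sidon_bij A G" "fst ` G = A" "snd ` G = A"
    and meets: "\<And>X Y. X \<in> \<B> \<Longrightarrow> Y \<in> \<B> \<Longrightarrow> G \<inter> X \<times> Y \<noteq> {}"
    by blast
  \<comment> \<open>The value is the height of the unique point of \<open>G\<close> above
    \<open>x\<close>.\<close>
  define f where "f = (\<lambda>x. snd (the_inv_into G fst x))"
  have inj: "inj_on fst G" "inj_on snd G" and sidon: "sidon G"
    using G(1) by (auto simp: partial_sidon_bij_def)
  have f: "f (fst p) = snd p" if "p \<in> G" for p
    using that by (simp add: f_def the_inv_into_f_f[OF inj(1)])
  have graph: "graph_on A f = G"
    unfolding graph_on_def G(2)[symmetric] using f by force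
  have "bij_betw (the_inv_into G fst) A G"
    using inj(1) G(2) by (intro bij_betw_the_inv_into) (simp add: bij_betw_def)
  moreover have "bij_betw snd G A" using inj(2) G(3) by (simp add: bij_betw_def)
  ultimately have bij: "bij_betw f A A"
    unfolding f_def using bij_betw_trans by (fastforce simp: comp_def)
  have dense: "{0..1} \<times> {0..1} \<subseteq> closure (graph_on A f)"
  proof (clarify, unfold closure_approachable graph, intro allI impI)
    fix x y e :: real
    assume x: "x \<in> {0..1}" and y: "y \<in> {0..1}" and e: "e > 0"
    \<comment> \<open>Half of \<open>e\<close> per coordinate suffices, since the distance in the
      plane is at most the sum of the coordinate distances.\<close>
    obtain a b where ab: "a \<in> A" "b \<in> A" "a < b" "{a<..<b} \<subseteq> ball x (e/2)"
      using rational_interval_near[OF x, of "e/2"] e unfolding A_def by auto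
    obtain c d where cd: "c \<in> A" "d \<in> A" "c < d" "{c<..<d} \<subseteq> ball y (e/2)"
      using rational_interval_near[OF y, of "e/2"] e unfolding A_def by auto
    have "{a<..<b} \<inter> \<rat> \<in> \<B>" "{c<..<d} \<inter> \<rat> \<in> \<B>"
      using ab cd by (auto simp: \<B>_def)
    from meets[OF this] obtain p
      where p: "p \<in> G" "p \<in> ({a<..<b} \<inter> \<rat>) \<times> ({c<..<d} \<inter> \<rat>)"
      by blast
    then have "fst p \<in> {a<..<b}" "snd p \<in> {c<..<d}" by auto
    then have "dist (fst p) x < e/2" "dist (snd p) y < e/2"
      using ab(4) cd(4) by (metis dist_commute mem_ball subsetD)+
    then have "dist p (x, y) < e"
      using sqrt_sum_squares_le_sum[of "dist (fst p) x" "dist (snd p) y"]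
      by (simp add: dist_prod_def)
    with p(1) show "\<exists>p\<in>G. dist p (x, y) < e" by blast
  qed
  have "rational_costas_cloud A f"
    unfolding rational_costas_cloud_def
  proof (intro conjI ballI)
    show "A \<subseteq> \<rat>" by (simp add: A_def)
    show "f \<in> A \<rightarrow> A" "inj_on f A" using bij by (auto simp: bij_betw_def)
    show "costas_on A f" using costas_on_if_sidon_graph graph sidon by simp
    show "\<not> continuous (at x within A) f" if "x \<in> A" for x
      using not_continuous_if_dense_graph[OF dense] that by (simp add: A_def)
    show "closed_interval_hull A \<times> closed_interval_hull A \<subseteq> closure (graph_on A f)"
      using dense by (simp add: A_def closed_interval_hull_unit_rationals)
  qed
  with bij show ?thesis unfolding A_def by blast
qed

end
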